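(* Suppose that $\mathbb F$ has characteristic $p\neq2$ and let $0\le k\le n$. Then $$M^n_k=E_{k,0}\oplus E_{k,1}\oplus\cdots\oplus E_{k,k},$$ where $E_{k,j}$ has dimension $\binom nk\binom kj$ and basis $C_{k,j}$ for $0\le j\le k$. Furthermore, $\sigma_k$ restricts to a map $\sigma_{k,j}:E_{k,j}\to E_{k,j}$ with $\sigma_{k,j}=(k-2j)I$ for all $0\le j\le k$, where $I$ is the identity map on $E_{k,j}$.
   Context: Let $V=\{\alpha_1,\bar\alpha_1,\dots,\alpha_n,\bar\alpha_n\}$ be a set of $2n$ distinct elements, with $\bar{\bar\alpha}_i=\alpha_i$. For $0\le k\le n$, $L^n_k$ is the set of $k$-element subsets $x\subseteq V$ with $|x\cap\{\alpha_i,\bar\alpha_i\}|\le1$ for all $i$, and $M^n_k$ is the $\mathbb F$-vector space with basis $L^n_k$. Elements are written as polynomials in the vertices: a product of distinct vertices forming such a set denotes that set, extended bilinearly. $\sigma_k:M^n_k\to M^n_k$ is the linear map with $\sigma_k(x)=\sum_{\gamma\in x}(x\setminus\{\gamma\})\cup\{\bar\gamma\}$. Let $\dot V=\{\alpha_1,\dots,\alpha_n\}$; for disjoint $a,b\subseteq\dot V$, $[a,b]=\prod_{\alpha\in a}(\alpha+\bar\alpha)\prod_{\beta\in b}(\beta-\bar\beta)\in M^n_{|a|+|b|}$, with $[\emptyset,\emptyset]=\emptyset$. For $0\le j\le k$, $C_{k,j}=\{[a,b]: a,b\subseteq\dot V\text{ disjoint}, |a|=k-j, |b|=j\}$ and $E_{k,j}$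 is the subspace of $M^n_k$ spanned by $C_{k,j}$. *)

theory Defs
  imports "HOL-Library.Multiset" "HOL-Library.Poly_Mapping" "HOL-Library.FuncSet"
    "HOL-Computational_Algebra.Computational_Algebra"
begin

section \<open>Vertices and faces\<close>

datatype vertex = Alpha nat | AlphaBar nat

fun bar :: "vertex \<Rightarrow> vertex" where
  "bar (Alpha i) = AlphaBar i"
| "bar (AlphaBar i) = Alpha i"

definition verts :: "nat \<Rightarrow> vertex set" where
  "verts n = Alpha ` {1..n} \<union> AlphaBar ` {1..n}"

definition dot_verts :: "nat \<Rightarrow> vertex set" where
  "dot_verts n = Alpha ` {1..n}"

definition faces :: "nat \<Rightarrow> nat \<Rightarrow> vertex set set" where
  "faces n k = {x. x \<subseteq> verts n \<and> card x = k \<and>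
     (\<forall>i\<in>{1..n}. card (x \<inter> {Alpha i, AlphaBar i}) \<le> 1)}"

lemma finite_faces: "finite (faces n k)"
  by (rule finite_subset[of _ "Pow (verts n)"]) (auto simp: faces_def verts_def)

lemma finite_face: "x \<in> faces n k \<Longrightarrow> finite x"
  by (rule finite_subset[of _ "verts n"]) (auto simp: faces_def verts_def)


section \<open>Polynomials in the vertices\<close>

text \<open>
  A monomial is a multiset of vertices, so that the convolution product of
  \<^theory>\<open>HOL-Library.Poly_Mapping\<close> is the usual product of polynomials.
  A set of vertices is identified with the product of its elements, which makes
  the space with basis \<open>faces n k\<close> a subspace of the polynomial ring.
\<close>

type_synonym 'f vpoly = "vertex multiset \<Rightarrow>\<^sub>0 'f"

definition scale :: "'f::field \<Rightarrow> 'f vpoly \<Rightarrow> 'f vpoly" where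
  "scale c = Poly_Mapping.map ((*) c)"

lemma lookup_scale [simp]: "Poly_Mapping.lookup (scale c p) m = c * Poly_Mapping.lookup p m"
  by (simp add: scale_def map.rep_eq when_def)

interpretation vp: vector_space "scale :: 'f::field \<Rightarrow> 'f vpoly \<Rightarrow> 'f vpoly"
  by unfold_locales (auto intro!: poly_mapping_eqI simp: lookup_add algebra_simps)

definition var :: "vertex \<Rightarrow> 'f::field vpoly" where
  "var v = Poly_Mapping.single {#v#} 1"

definition mon :: "vertex set \<Rightarrow> 'f::field vpoly" where
  "mon x = (\<Prod>v\<in>x. var v)"

lemma mon_eq_single:
  assumes "finite x"
  shows "mon x = Poly_Mapping.single (mset_set x) 1"
  using assms
  by (induction x rule: finite_induct) (simp_all add: mon_def var_def mult_single)

definition M_space :: "nat \<Rightarrow> nat \<Rightarrow> 'f::field vpoly set" where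
  "M_space n k = vp.span (mon ` faces n k)"

text \<open>The faces (as monomials) are distinct and linearly independent, hence a basis.\<close>

lemma lookup_mon:
  assumes "finite x" "finite y"
  shows "Poly_Mapping.lookup (mon x :: 'f::field vpoly) (mset_set y) = (if x = y then 1 else 0)"
  using assms by (auto simp: mon_eq_single lookup_single when_def mset_set_eq_iff)

lemma inj_on_mon: "inj_on (mon :: _ \<Rightarrow> 'f::field vpoly) (faces n k)"
proof (rule inj_onI)
  fix x y
  assume x: "x \<in> faces n k" and y: "y \<in> faces n k" and eq: "(mon x :: 'f vpoly) = mon y"
  have "(if x = y then 1 else 0) = Poly_Mapping.lookup (mon x :: 'f vpoly) (mset_set y)"
    using x y by (simp add: lookup_mon finite_face)
  also have "\<dots> = (1 :: 'f)"
    unfolding eq using y by (simp add: lookup_mon finite_face)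
  finally show "x = y"
    by (simp split: if_splits)
qed

lemma independent_faces: "vp.independent (mon ` faces n k :: 'f::field vpoly set)"
proof -
  have "u (mon y) = 0"
    if y: "y \<in> faces n k" and s: "(\<Sum>v\<in>mon ` faces n k. scale (u v) v) = (0 :: 'f vpoly)" for u y
  proof -
    have "0 = Poly_Mapping.lookup (\<Sum>x\<in>faces n k. scale (u (mon x)) (mon x)) (mset_set y)"
      using s by (simp add: sum.reindex[OF inj_on_mon] o_def)
    also have "\<dots> = (\<Sum>x\<in>faces n k. if x = y then u (mon x) else 0)"
      unfolding lookup_sum
      by (rule sum.cong) (use y in \<open>auto simp: lookup_mon finite_face\<close>)
    also have "\<dots> = u (mon y)"
      using y by (simp add: finite_faces)
    finally show ?thesis by simp
  qed
  then show ?thesis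
    by (auto simp: vp.dependent_finite finite_faces)
qed


section \<open>The map sigma\<close>

text \<open>
  Extended linearly from the values on faces; on \<open>M_space n k\<close> the coefficient at
  \<open>mset_set x\<close> is the coordinate at the face \<open>x\<close>.
\<close>

definition sigma :: "nat \<Rightarrow> nat \<Rightarrow> 'f::field vpoly \<Rightarrow> 'f vpoly" where
  "sigma n k p = (\<Sum>x\<in>faces n k. scale (Poly_Mapping.lookup p (mset_set x))
     (\<Sum>\<gamma>\<in>x. mon ((x - {\<gamma>}) \<union> {bar \<gamma>})))"

lemma linear_sigma:
  "Vector_Spaces.linear scale scale (sigma n k :: 'f::field vpoly \<Rightarrow> 'f vpoly)"
  unfolding module_hom_iff_linear[symmetric] module_hom_iff
  by (simp add: vp.module_axioms sigma_def lookup_add vp.scale_left_distrib sum.distrib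
      vp.scale_sum_right)

lemma sigma_mon:
  assumes "x \<in> faces n k"
  shows "sigma n k (mon x) = (\<Sum>\<gamma>\<in>x. mon ((x - {\<gamma>}) \<union> {bar \<gamma>}) :: 'f::field vpoly)"
proof -
  have "sigma n k (mon x) =
      (\<Sum>y\<in>faces n k. if y = x then \<Sum>\<gamma>\<in>y. mon ((y - {\<gamma>}) \<union> {bar \<gamma>}) else 0 :: 'f vpoly)"
    unfolding sigma_def
    by (rule sum.cong) (use assms in \<open>auto simp: lookup_mon finite_face\<close>)
  then show ?thesis
    using assms by (simp add: finite_faces)
qed


lemma flip_face:
  assumes x: "x \<in> faces n k" and g: "\<gamma> \<in> x"
  shows "(x - {\<gamma>}) \<union> {bar \<gamma>} \<in> faces n k"
proof -
  have fin: "finite x" using x by (rule finite_face)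
  from x g obtain i where i: "i \<in> {1..n}" "\<gamma> = Alpha i \<or> \<gamma> = AlphaBar i"
    by (auto simp: faces_def verts_def)
  have le: "card (x \<inter> {Alpha j, AlphaBar j}) \<le> 1" if "j \<in> {1..n}" for j
    using x that by (auto simp: faces_def)
  have bar_ne: "bar \<gamma> \<noteq> \<gamma>" using i by auto
  have nb: "bar \<gamma> \<notin> x"
  proof
    assume "bar \<gamma> \<in> x"
    then have "{\<gamma>, bar \<gamma>} \<subseteq> x \<inter> {Alpha i, AlphaBar i}"
      using i g by auto
    then have "card {\<gamma>, bar \<gamma>} \<le> 1"
      using le[OF i(1)] by (meson card_mono finite.intros finite_Int le_trans)
    then show False using bar_ne by simp
  qed
  have "card ((x - {\<gamma>}) \<union> {bar \<gamma>}) = k"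
  proof -
    have "0 < card x" using fin g card_gt_0_iff by blast
    then show ?thesis using fin g nb x by (simp add: faces_def)
  qed
  moreover have "(x - {\<gamma>}) \<union> {bar \<gamma>} \<subseteq> verts n"
    using x i by (auto simp: faces_def verts_def)
  moreover have "card (((x - {\<gamma>}) \<union> {bar \<gamma>}) \<inter> {Alpha j, AlphaBar j}) \<le> 1"
    if j: "j \<in> {1..n}" for j
  proof (cases "j = i")
    case True
    then have "((x - {\<gamma>}) \<union> {bar \<gamma>}) \<inter> {Alpha j, AlphaBar j} \<subseteq> {bar \<gamma>}"
      using i by auto
    then show ?thesis by (metis card.empty card_1_singleton_iff One_nat_def
        le_refl subset_singletonD zero_le)
  next
    case False
    then have "((x - {\<gamma>}) \<union> {bar \<gamma>}) \<inter> {Alpha j, AlphaBar j} \<subseteq> x \<inter> {Alpha j, AlphaBar j}"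
      using i by auto
    then show ?thesis
      using le[OF j] by (meson card_mono finite.intros finite_Int le_trans)
  qed
  ultimately show ?thesis by (simp add: faces_def)
qed

lemma sigma_in_M_space: "sigma n k p \<in> M_space n k"
  unfolding sigma_def M_space_def
  by (intro vp.span_sum vp.span_scale vp.span_base imageI flip_face)


section \<open>The subspaces E\<close>

definition bracket :: "vertex set \<Rightarrow> vertex set \<Rightarrow> 'f::field vpoly" where
  "bracket a b = (\<Prod>\<alpha>\<in>a. var \<alpha> + var (bar \<alpha>)) * (\<Prod>\<beta>\<in>b. var \<beta> - var (bar \<beta>))"

definition C_set :: "nat \<Rightarrow> nat \<Rightarrow> nat \<Rightarrow> 'f::field vpoly set" where
  "C_set n k j = {bracket a b | a b. a \<subseteq> dot_verts n \<and> b \<subseteq> dot_verts n \<and> a \<inter> b = {} \<and>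
     card a = k - j \<and> card b = j}"

definition E_space :: "nat \<Rightarrow> nat \<Rightarrow> nat \<Rightarrow> 'f::field vpoly set" where
  "E_space n k j = vp.span (C_set n k j)"

text \<open>Internal direct sum of a finite family of subspaces.\<close>

definition is_direct_sum :: "'f::field vpoly set \<Rightarrow> 'i set \<Rightarrow> ('i \<Rightarrow> 'f vpoly set) \<Rightarrow> bool" where
  "is_direct_sum W I U \<longleftrightarrow>
     vp.subspace W \<and> (\<forall>i\<in>I. vp.subspace (U i) \<and> U i \<subseteq> W) \<and>
     (\<forall>w\<in>W. \<exists>!u. u \<in> Pi\<^sub>E I U \<and> w = (\<Sum>i\<in>I. u i))"

end

theory Submission
  imports Defs "HOL-Library.Disjoint_Sets"
begin

text \<open>
  On monomials avoiding \<open>\<alpha>\<close> and \<open>bar \<alpha>\<close>, \<open>sigma\<close> obeys the Leibniz rule with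
  \<open>\<alpha> \<mapsto> bar \<alpha>\<close>. So each factor \<open>\<alpha> + bar \<alpha>\<close> of a bracket adds \<open>1\<close> to the eigenvalue,
  and each factor \<open>\<beta> - bar \<beta>\<close> adds \<open>-1\<close>.
  Since \<open>2\<close> is invertible, each vertex is a combination of the two factors of its pair, so the
  brackets span \<open>M_space n k\<close>. They are indexed by at most as many pairs as there are faces,
  so they are independent and pairwise distinct. Directness thus comes from counting and not from
  the eigenvalues \<open>k - 2j\<close>, which may coincide in odd characteristic.
\<close>

section \<open>Independence and direct sums in a vector space\<close>

context vector_space
begin

text \<open>A basis chosen inside \<open>S\<close> has \<open>dim S\<close> elements, so the bound
  on \<open>card S\<close> forces it to be all of \<open>S\<close>.\<close>

lemma independent_if_card_le_dim:
  assumes "finite S" "card S \<le> dim S"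
  shows "independent S"
proof -
  obtain B where B: "B \<subseteq> S" "independent B" "S \<subseteq> span B" "card B = dim S"
    using basis_exists by blast
  then have "B = S"
    using assms card_seteq by metis
  then show ?thesis using B(2) by simp
qed

text \<open>Coordinates with respect to \<open>B\<close> are unique, so those of \<open>v\<close>
  vanish both off \<open>S\<close> and off \<open>T\<close>, hence everywhere.\<close>

lemma independent_spans_disjoint:
  assumes B: "independent B" and sub: "S \<subseteq> B" "T \<subseteq> B" and "S \<inter> T = {}"
    and v: "v \<in> span S" "v \<in> span T"
  shows "v = 0"
proof -
  have "representation B v = representation S v" "representation B v = representation T v"
    using representation_extend[OF B] v sub by blast+
  then have "representation B v b = 0" for b
    using representation_ne_zero[of S v b] representation_ne_zero[of T v b] \<open>S \<inter> T = {}\<close> by auto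
  moreover have "v \<in> span B"
    using v(1) sub(1) span_mono by blast
  ultimately show ?thesis
    using sum_nonzero_representation_eq[OF B, of v] by simp
qed

text \<open>A vanishing sum makes \<open>d i\<close> the negative of the sum of the other terms. It
  then lies in the spans of two disjoint parts of one independent set.\<close>

lemma independent_family_sum_eq_0:
  assumes I: "finite I" and B: "independent (\<Union>i\<in>I. B i)" and disj: "disjoint_family_on B I"
    and d: "\<And>i. i \<in> I \<Longrightarrow> d i \<in> span (B i)" and s: "(\<Sum>i\<in>I. d i) = 0" and i: "i \<in> I"
  shows "d i = 0"
proof (rule independent_spans_disjoint[OF B])
  show "B i \<subseteq> (\<Union>i\<in>I. B i)" "(\<Union>j\<in>I - {i}. B j) \<subseteq> (\<Union>i\<in>I. B i)"
    using i by auto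
  show "B i \<inter> (\<Union>j\<in>I - {i}. B j) = {}"
    using disj i by (fastforce simp: disjoint_family_on_def)
  show "d i \<in> span (B i)" by (rule d[OF i])
  have "d i = - (\<Sum>j\<in>I - {i}. d j)"
    using s I i by (simp add: sum.remove eq_neg_iff_add_eq_0)
  also have "\<dots> \<in> span (\<Union>j\<in>I - {i}. B j)"
    using d by (intro span_neg span_sum) (meson UN_upper span_mono subsetD DiffD1)
  finally show "d i \<in> span (\<Union>j\<in>I - {i}. B j)" .
qed

text \<open>Grouping a linear combination by blocks gives existence. Uniqueness follows because the
  differences of two decompositions sum to zero.\<close>

lemma span_disjoint_family_ex1:
  assumes I: "finite I" and fin: "\<And>i. i \<in> I \<Longrightarrow> finite (B i)"
    and B: "independent (\<Union>i\<in>I. B i)" and disj: "disjoint_family_on B I"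
    and w: "w \<in> span (\<Union>i\<in>I. B i)"
  shows "\<exists>!u. u \<in> (\<Pi>\<^sub>E i\<in>I. span (B i)) \<and> w = (\<Sum>i\<in>I. u i)"
proof -
  obtain r where "w = (\<Sum>b\<in>(\<Union>i\<in>I. B i). scale (r b) b)"
    using w I fin by (auto simp: span_finite)
  also have "\<dots> = (\<Sum>i\<in>I. \<Sum>b\<in>B i. scale (r b) b)"
    using I fin disj by (intro sum.UNION_disjoint) (auto simp: disjoint_family_on_def)
  \<comment> \<open>The restricted abstraction makes the witness \<open>undefined\<close> outside
    \<open>I\<close>, as membership in the extensional product demands.\<close>
  finally have w_eq: "w = (\<Sum>i\<in>I. (\<lambda>i\<in>I. \<Sum>b\<in>B i. scale (r b) b) i)"
    by simp
  have mem: "(\<Sum>b\<in>B i. scale (r b) b) \<in> span (B i)" for i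
    by (intro span_sum span_scale span_base)
  show ?thesis
  proof (rule ex1I)
    show "(\<lambda>i\<in>I. \<Sum>b\<in>B i. scale (r b) b) \<in> (\<Pi>\<^sub>E i\<in>I. span (B i)) \<and>
        w = (\<Sum>i\<in>I. (\<lambda>i\<in>I. \<Sum>b\<in>B i. scale (r b) b) i)"
      using w_eq mem by auto
  next
    fix u
    assume u: "u \<in> (\<Pi>\<^sub>E i\<in>I. span (B i)) \<and> w = (\<Sum>i\<in>I. u i)"
    let ?u = "\<lambda>i\<in>I. \<Sum>b\<in>B i. scale (r b) b"
    have "u i - ?u i = 0" if "i \<in> I" for i
    proof (rule independent_family_sum_eq_0[OF I B disj _ _ that])
      show "u i - ?u i \<in> span (B i)" if "i \<in> I" for i
        using u that mem by (auto intro: span_diff)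
      show "(\<Sum>i\<in>I. u i - ?u i) = 0"
        using u w_eq by (simp add: sum_subtractf)
    qed
    then have "u i = ?u i" if "i \<in> I" for i
      using that by (metis eq_iff_diff_eq_0)
    moreover have "?u \<in> (\<Pi>\<^sub>E i\<in>I. span (B i))"
      using mem by auto
    ultimately show "u = ?u"
      using u by (meson PiE_ext)
  qed
qed

end

section \<open>Scalars as constant polynomials, bars and faces\<close>

lemma scale_eq_mult: "scale c p = Poly_Mapping.single 0 c * p"
  unfolding scale_def by (rule mult_map_scale_conv_mult)

lemma scale_mult_left: "scale c p * q = scale c (p * q)"
  by (simp add: scale_eq_mult mult.assoc)

lemma scale_mult_right: "p * scale c q = scale c (p * q)"
  by (simp add: scale_eq_mult mult.left_commute)

lemma span_mult_mem:
  assumes "\<And>x. x \<in> S \<Longrightarrow> p * x \<in> vp.span T" "u \<in> vp.span S"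
  shows "p * u \<in> vp.span T"
  using assms(2)
  by (induction rule: vp.span_induct_alt)
    (auto simp: distrib_left scale_mult_right intro!: vp.span_zero vp.span_add vp.span_scale assms(1))

lemma bar_bar [simp]: "bar (bar v) = v"
  by (cases v) auto

lemma bar_eq_iff [simp]: "bar v = bar w \<longleftrightarrow> v = w"
  by (metis bar_bar)

lemma bar_neq [simp]: "bar v \<noteq> v" "v \<noteq> bar v"
  by (cases v; simp)+

lemma bar_mem_verts [simp]: "bar v \<in> verts n \<longleftrightarrow> v \<in> verts n"
  by (cases v) (auto simp: verts_def)

lemma dot_verts_subset_verts: "dot_verts n \<subseteq> verts n"
  by (auto simp: dot_verts_def verts_def)

lemma finite_dot_verts [simp]: "finite (dot_verts n)"
  by (simp add: dot_verts_def)

lemma bar_mem_dot_verts: "v \<in> dot_verts n \<Longrightarrow> bar v \<notin> dot_verts n"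
  by (auto simp: dot_verts_def)

text \<open>Inside \<open>verts n\<close> the only vertex sharing the index of \<open>v\<close> is
  \<open>bar v\<close>. This index-free form is the one suited to inserting vertices one at a
  time.\<close>

lemma faces_iff:
  "x \<in> faces n k \<longleftrightarrow> x \<subseteq> verts n \<and> card x = k \<and> (\<forall>v\<in>x. bar v \<notin> x)"
proof -
  have "card (x \<inter> {Alpha i, AlphaBar i}) \<le> 1 \<longleftrightarrow> \<not> (Alpha i \<in> x \<and> AlphaBar i \<in> x)" for i
    by (cases "Alpha i \<in> x"; cases "AlphaBar i \<in> x") (auto simp: Int_insert_right)
  moreover have "(\<forall>i\<in>{1..n}. \<not> (Alpha i \<in> x \<and> AlphaBar i \<in> x)) \<longleftrightarrow> (\<forall>v\<in>x. bar v \<notin> x)"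
    if "x \<subseteq> verts n"
    using that by (fastforce simp: verts_def)
  ultimately show ?thesis
    by (auto simp: faces_def)
qed

lemma insert_face:
  assumes "x \<in> faces n k" "v \<in> verts n" "v \<notin> x" "bar v \<notin> x"
  shows "insert v x \<in> faces n (Suc k)"
proof -
  have "bar w \<noteq> v" if "w \<in> x" for w
    using that assms(4) by auto
  then show ?thesis
    using assms finite_face[OF assms(1)] by (auto simp: faces_iff)
qed

section \<open>Leibniz rule for sigma and the brackets as eigenvectors\<close>

lemma mon_insert: "finite x \<Longrightarrow> v \<notin> x \<Longrightarrow> mon (insert v x) = var v * mon x"
  by (simp add: mon_def)

text \<open>Flipping \<open>v\<close> itself yields the first term; every other flip keeps
  \<open>v\<close> as a factor. No such flip creates a second \<open>v\<close>, because only
  \<open>bar v\<close> flips to \<open>v\<close> and \<open>bar v\<close> is not in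
  \<open>x\<close>.\<close>

lemma sigma_var_mult_mon:
  assumes x: "x \<in> faces n k" and v: "v \<in> verts n" "v \<notin> x" "bar v \<notin> x"
  shows "sigma n (Suc k) (var v * mon x) = var (bar v) * mon x + var v * sigma n k (mon x)"
proof -
  have fin: "finite x" using x by (rule finite_face)
  have "sigma n (Suc k) (var v * mon x) =
      (\<Sum>\<gamma>\<in>insert v x. mon ((insert v x - {\<gamma>}) \<union> {bar \<gamma>}))"
    using fin v sigma_mon[OF insert_face[OF x v]] by (simp add: mon_insert)
  also have "\<dots> = mon (insert (bar v) x) + (\<Sum>\<gamma>\<in>x. mon ((insert v x - {\<gamma>}) \<union> {bar \<gamma>}))"
    using fin v by simp
  also have "(\<Sum>\<gamma>\<in>x. mon ((insert v x - {\<gamma>}) \<union> {bar \<gamma>})) =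
      (\<Sum>\<gamma>\<in>x. var v * mon ((x - {\<gamma>}) \<union> {bar \<gamma>}))"
  proof (rule sum.cong)
    fix \<gamma> assume g: "\<gamma> \<in> x"
    then have "(insert v x - {\<gamma>}) \<union> {bar \<gamma>} = insert v ((x - {\<gamma>}) \<union> {bar \<gamma>})"
      using v by auto
    moreover have "v \<notin> (x - {\<gamma>}) \<union> {bar \<gamma>}"
      using g v by auto
    ultimately show "mon ((insert v x - {\<gamma>}) \<union> {bar \<gamma>}) = var v * mon ((x - {\<gamma>}) \<union> {bar \<gamma>})"
      using fin mon_insert[of "(x - {\<gamma>}) \<union> {bar \<gamma>}" v] by simp
  qed simp
  finally show ?thesis
    using fin v by (simp add: mon_insert sigma_mon[OF x] sum_distrib_left)
qed

text \<open>Both sides are linear in \<open>u\<close>, so the rule for single faces avoiding the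
  pair of \<open>v\<close> extends to their span.\<close>

lemma sigma_var_mult:
  assumes v: "v \<in> verts n"
    and u: "u \<in> vp.span (mon ` {x \<in> faces n k. v \<notin> x \<and> bar v \<notin> x})"
  shows "sigma n (Suc k) (var v * u) = var (bar v) * u + var v * sigma n k u"
proof -
  interpret s: Vector_Spaces.linear scale scale "sigma n k" by (rule linear_sigma)
  interpret s': Vector_Spaces.linear scale scale "sigma n (Suc k)" by (rule linear_sigma)
  show ?thesis
    using u
  proof (induction rule: vp.span_induct_alt)
    case base
    then show ?case by (simp add: s.zero s'.zero)
  next
    case (step c p q)
    then show ?case
      using v by (auto simp: sigma_var_mult_mon s.add s.scale s'.add s'.scale distrib_left
          scale_mult_right vp.scale_right_distrib)
  qed
qed

text \<open>By the Leibniz rule the new factor contributes \<open>bar \<alpha> + s \<alpha>\<close>,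
  which equals \<open>s (\<alpha> + s bar \<alpha>)\<close> as \<open>s * s = 1\<close>. One
  computation thus serves both signs. The set \<open>A\<close> records which pairs \<open>u\<close>
  may involve, so that the rule applies to \<open>\<alpha>\<close> and to
  \<open>bar \<alpha>\<close>.\<close>

lemma sigma_factor_mult:
  fixes s c :: "'f::field"
  assumes \<alpha>: "\<alpha> \<in> verts n" "\<alpha> \<notin> A \<union> bar ` A" and s: "s * s = 1"
    and u: "u \<in> vp.span (mon ` {x \<in> faces n k. x \<subseteq> A \<union> bar ` A})"
    and eig: "sigma n k u = scale c u"
  defines "w \<equiv> (var \<alpha> + scale s (var (bar \<alpha>))) * u"
  shows "w \<in> vp.span (mon ` {x \<in> faces n (Suc k). x \<subseteq> insert \<alpha> A \<union> bar ` insert \<alpha> A})"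
    and "sigma n (Suc k) w = scale (c + s) w"
proof -
  interpret s': Vector_Spaces.linear scale scale "sigma n (Suc k) :: 'f vpoly \<Rightarrow> _"
    by (rule linear_sigma)
  let ?S = "mon ` {x \<in> faces n (Suc k). x \<subseteq> insert \<alpha> A \<union> bar ` insert \<alpha> A} :: 'f vpoly set"
  have \<alpha>': "bar \<alpha> \<notin> A \<union> bar ` A"
    using \<alpha>(2) by (auto simp: image_iff)
  have mem: "var v * u \<in> vp.span ?S" if v: "v = \<alpha> \<or> v = bar \<alpha>" for v
  proof (rule span_mult_mem[OF _ u])
    fix p :: "'f vpoly"
    assume "p \<in> mon ` {x \<in> faces n k. x \<subseteq> A \<union> bar ` A}"
    then obtain x where x: "p = mon x" "x \<in> faces n k" "x \<subseteq> A \<union> bar ` A" by auto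
    have nm: "v \<notin> x" "bar v \<notin> x"
      using v \<alpha>(2) \<alpha>' x(3) by auto
    have "insert v x \<in> faces n (Suc k)"
      using nm x v \<alpha>(1) by (intro insert_face) auto
    moreover have "insert v x \<subseteq> insert \<alpha> A \<union> bar ` insert \<alpha> A"
      using v x(3) by auto
    ultimately have "mon (insert v x) \<in> ?S" by blast
    then show "var v * p \<in> vp.span ?S"
      using nm x finite_face[OF x(2)] by (simp add: mon_insert vp.span_base)
  qed
  have w_eq: "w = var \<alpha> * u + scale s (var (bar \<alpha>) * u)"
    by (simp add: w_def distrib_right scale_mult_left)
  show "w \<in> vp.span ?S"
    unfolding w_eq by (intro vp.span_add vp.span_scale mem) auto
  have der: "sigma n (Suc k) (var v * u) = var (bar v) * u + scale c (var v * u)"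
    if v: "v = \<alpha> \<or> v = bar \<alpha>" for v
  proof -
    have "u \<in> vp.span (mon ` {x \<in> faces n k. v \<notin> x \<and> bar v \<notin> x})"
      using u by (rule subsetD[OF vp.span_mono[OF image_mono], rotated]) (use v \<alpha>(2) \<alpha>' in auto)
    then show ?thesis
      using sigma_var_mult[of v n u k] v \<alpha>(1) by (auto simp: eig scale_mult_right)
  qed
  have "sigma n (Suc k) w = var (bar \<alpha>) * u + scale c (var \<alpha> * u)
      + scale s (var \<alpha> * u + scale c (var (bar \<alpha>) * u))"
    using der[of \<alpha>] der[of "bar \<alpha>"] by (simp add: w_eq s'.add s'.scale)
  also have "\<dots> = scale (c + s) w"
    by (simp add: w_eq vp.scale_right_distrib vp.scale_left_distrib
        distrib_right[of c s s] s mult.commute[of s c])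
  finally show "sigma n (Suc k) w = scale (c + s) w" .
qed

text \<open>The factors are attached one at a time, those of \<open>a\<close> with
  \<open>s = 1\<close> and then those of \<open>b\<close> with \<open>s = -1\<close>. The span claim
  strengthens the induction: it guarantees that the pair of the next vertex does not yet
  occur.\<close>

lemma bracket_eigenvector:
  assumes "finite a" "finite b" "a \<subseteq> dot_verts n" "b \<subseteq> dot_verts n" "a \<inter> b = {}"
  shows "(bracket a b :: 'f::field vpoly) \<in>
        vp.span (mon ` {x \<in> faces n (card a + card b). x \<subseteq> (a \<union> b) \<union> bar ` (a \<union> b)})
      \<and> sigma n (card a + card b) (bracket a b) =
        scale (of_int (int (card a) - int (card b))) (bracket a b :: 'f vpoly)"
  using assms(2,1,3-)
proof (induction b rule: finite_induct)
  case empty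
  then show ?case
  proof (induction a rule: finite_induct)
    case empty
    have e: "{} \<in> faces n 0" by (simp add: faces_iff)
    have "sigma n 0 (mon {}) = (0 :: 'f vpoly)"
      using sigma_mon[OF e] by simp
    moreover have "bracket {} {} = (mon {} :: 'f vpoly)"
      by (simp add: bracket_def mon_def)
    ultimately show ?case
      using e by (auto intro!: vp.span_base)
  next
    case (insert \<alpha> a)
    \<comment> \<open>All of \<open>a\<close> is unbarred and so is \<open>\<alpha>\<close>, hence
      \<open>\<alpha>\<close> is not the bar of an element of \<open>a\<close>.\<close>
    have \<alpha>: "\<alpha> \<in> verts n" "\<alpha> \<notin> a \<union> bar ` a"
      using insert dot_verts_subset_verts bar_mem_dot_verts[of _ n] by auto
    have eq: "bracket (insert \<alpha> a) {} = (var \<alpha> + scale 1 (var (bar \<alpha>))) * (bracket a {} :: 'f vpoly)"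
      using insert by (simp add: bracket_def)
    show ?case
      using sigma_factor_mult[where s = "1::'f" and A = a and k = "card a", OF \<alpha>,
          of "bracket a {}" "of_int (int (card a))"] insert
      unfolding eq by (simp add: add.commute)
  qed
next
  case (insert \<beta> b)
  have \<beta>: "\<beta> \<in> verts n" "\<beta> \<notin> (a \<union> b) \<union> bar ` (a \<union> b)"
    using insert dot_verts_subset_verts bar_mem_dot_verts[of _ n] by auto
  have eq: "bracket a (insert \<beta> b) = (var \<beta> + scale (- 1) (var (bar \<beta>))) * (bracket a b :: 'f vpoly)"
    using insert by (simp add: bracket_def algebra_simps)
  show ?case
    using sigma_factor_mult[where s = "-1::'f" and A = "a \<union> b" and k = "card a + card b", OF \<beta>,
        of "bracket a b" "of_int (int (card a) - int (card b))"] insert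
    unfolding eq by (simp add: algebra_simps)
qed

section \<open>Index pairs of the brackets, and the span of the brackets\<close>

definition disjoint_pairs :: "nat \<Rightarrow> nat \<Rightarrow> nat \<Rightarrow> (vertex set \<times> vertex set) set" where
  "disjoint_pairs n k j = {(a, b). a \<subseteq> dot_verts n \<and> b \<subseteq> dot_verts n \<and> a \<inter> b = {} \<and>
     card a = k - j \<and> card b = j}"

lemma finite_disjoint_pairs: "finite (disjoint_pairs n k j)"
  by (rule finite_subset[of _ "Pow (dot_verts n) \<times> Pow (dot_verts n)"])
    (auto simp: disjoint_pairs_def)

text \<open>Counting is done on index pairs. Whether distinct pairs give distinct brackets is left
  open here and settled together with independence.\<close>

lemma C_set_eq: "C_set n k j = (\<lambda>(a, b). bracket a b) ` disjoint_pairs n k j"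
  by (auto simp: C_set_def disjoint_pairs_def)

lemma card_dot_verts [simp]: "card (dot_verts n) = n"
  by (simp add: dot_verts_def card_image inj_on_def)

text \<open>Choosing \<open>b\<close> first and then \<open>a\<close> in its complement gives
  \<open>(n choose j) * ((n - j) choose (k - j))\<close>, which is the claimed product by the
  subset-of-a-subset identity.\<close>

lemma card_disjoint_pairs:
  assumes "j \<le> k" "k \<le> n"
  shows "card (disjoint_pairs n k j) = (n choose k) * (k choose j)"
proof -
  let ?Q = "SIGMA b:{b. b \<subseteq> dot_verts n \<and> card b = j}. {a. a \<subseteq> dot_verts n - b \<and> card a = k - j}"
  have "disjoint_pairs n k j = prod.swap ` ?Q"
    by (auto simp: disjoint_pairs_def image_iff)
  then have "card (disjoint_pairs n k j) = card ?Q"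
    by (simp add: card_image)
  also have "\<dots> = (\<Sum>b | b \<subseteq> dot_verts n \<and> card b = j. (n - j) choose (k - j))"
  proof (subst card_SigmaI)
    show "(\<Sum>b | b \<subseteq> dot_verts n \<and> card b = j. card {a. a \<subseteq> dot_verts n - b \<and> card a = k - j}) =
        (\<Sum>b | b \<subseteq> dot_verts n \<and> card b = j. (n - j) choose (k - j))"
    proof (rule sum.cong)
      fix b assume "b \<in> {b. b \<subseteq> dot_verts n \<and> card b = j}"
      then have "card (dot_verts n - b) = n - j"
        using card_Diff_subset[of b "dot_verts n"] finite_subset[OF _ finite_dot_verts] by auto
      then show "card {a. a \<subseteq> dot_verts n - b \<and> card a = k - j} = (n - j) choose (k - j)"
        by (simp add: n_subsets)
    qed simp
  qed auto
  also have "\<dots> = (n choose j) * ((n - j) choose (k - j))"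
    by (simp add: n_subsets)
  finally show ?thesis
    using choose_mult[OF assms] by simp
qed

text \<open>Each vertex of \<open>y\<close> is traded for half a plus factor and plus or minus half
  a minus factor, so its pair moves into \<open>a\<close> in one term and into \<open>b\<close> in
  the other. The total degree stays \<open>k\<close>; starting from \<open>a = b = {}\<close> this
  expands a face into brackets.\<close>

lemma mult_mon_mem_span_brackets:
  assumes "finite y" "(2::'f::field) \<noteq> 0"
    and "a \<subseteq> dot_verts n" "b \<subseteq> dot_verts n" "a \<inter> b = {}"
    and "y \<subseteq> verts n" "\<forall>v\<in>y. bar v \<notin> y" "y \<inter> (a \<union> b) = {}" "bar ` y \<inter> (a \<union> b) = {}"
    and "card a + card b + card y = k"
  shows "bracket a b * mon y \<in> vp.span (\<Union>j\<in>{0..k}. C_set n k j :: 'f vpoly set)"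
  using assms(1,3-)
proof (induction y arbitrary: a b rule: finite_induct)
  case empty
  then have "card a = k - card b"
    by simp
  then have "bracket a b \<in> C_set n k (card b)"
    using empty unfolding C_set_def by blast
  moreover have "card b \<in> {0..k}"
    using empty by simp
  ultimately show ?case
    by (auto simp: mon_def intro!: vp.span_base)
next
  case (insert v y)
  let ?W = "vp.span (\<Union>j\<in>{0..k}. C_set n k j :: 'f vpoly set)"
  \<comment> \<open>Here \<open>\<alpha>\<close> is the unbarred vertex of the pair of
    \<open>v\<close>, and \<open>s\<close> is \<open>1/2\<close> if \<open>v\<close> is unbarred and
    \<open>-1/2\<close> if it is barred.\<close>
  obtain \<alpha> s where \<alpha>: "\<alpha> \<in> dot_verts n" "v = \<alpha> \<or> v = bar \<alpha>"
    and s: "var v = scale (1/2) (var \<alpha> + var (bar \<alpha>)) + scale s (var \<alpha> - var (bar \<alpha>) :: 'f vpoly)"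
  proof -
    have four: "(4::'f) \<noteq> 0"
      using assms(2) mult_eq_0_iff[of "2::'f" 2] by simp
    have half: "scale (1/2) (p + q) + scale (1/2) (p - q) = p"
      "scale (1/2) (p + q) + scale (-1/2) (p - q) = q" for p q :: "'f vpoly"
      by (rule poly_mapping_eqI; simp only: lookup_add lookup_minus lookup_scale;
          simp add: field_simps assms(2) four)+
    show ?thesis
    proof (cases v)
      case (Alpha i)
      then have "v \<in> dot_verts n"
        using insert.prems(4) by (auto simp: verts_def dot_verts_def)
      then show ?thesis
        by (rule that[of v "1/2"]) (simp, rule half(1)[symmetric])
    next
      case (AlphaBar i)
      then have "bar v \<in> dot_verts n"
        using insert.prems(4) by (auto simp: verts_def dot_verts_def)
      then show ?thesis
        by (rule that[of "bar v" "-1/2"]) (simp, simp only: bar_bar half(2))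
    qed
  qed
  have fin: "finite a" "finite b"
    using insert.prems finite_subset[OF _ finite_dot_verts] by blast+
  \<comment> \<open>The two disjointness conditions exclude both \<open>v\<close> and
    \<open>bar v\<close> from \<open>a \<union> b\<close>, whichever of them is
    \<open>\<alpha>\<close>.\<close>
  have new: "\<alpha> \<notin> a" "\<alpha> \<notin> b" "\<alpha> \<notin> y" "bar \<alpha> \<notin> y"
    using insert.hyps insert.prems \<alpha> by auto
  have new': "\<alpha> \<notin> bar ` y"
    using new by auto
  have "bracket (insert \<alpha> a) b * mon y \<in> ?W" "bracket a (insert \<alpha> b) * mon y \<in> ?W"
    by (rule insert.IH; use insert.hyps insert.prems \<alpha> new new' fin in auto)+
  moreover have "bracket a b * mon (insert v y) =
      scale (1/2) (bracket (insert \<alpha> a) b * mon y) + scale s (bracket a (insert \<alpha> b) * mon y)"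
  proof -
    have "bracket (insert \<alpha> a) b = (var \<alpha> + var (bar \<alpha>)) * (bracket a b :: 'f vpoly)"
      "bracket a (insert \<alpha> b) = (var \<alpha> - var (bar \<alpha>)) * (bracket a b :: 'f vpoly)"
      using fin new by (simp_all add: bracket_def mult.left_commute mult.assoc)
    moreover have "bracket a b * mon (insert v y) = var v * (bracket a b * mon y :: 'f vpoly)"
      using insert.hyps by (simp add: mon_insert mult.left_commute)
    ultimately show ?thesis
      by (simp add: s distrib_right scale_mult_left mult.assoc)
  qed
  ultimately show ?case
    by (simp add: vp.span_add vp.span_scale)
qed

text \<open>With \<open>j \<le> k\<close> the truncated difference \<open>k - j\<close> and
  \<open>j\<close> add up to \<open>k\<close>, so the brackets are combinations of faces of size
  \<open>k\<close>.\<close>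

lemma C_set_subset_M_space:
  assumes "j \<le> k"
  shows "C_set n k j \<subseteq> (M_space n k :: 'f::field vpoly set)"
proof
  fix p :: "'f vpoly"
  assume "p \<in> C_set n k j"
  then obtain a b where ab: "p = bracket a b" "a \<subseteq> dot_verts n" "b \<subseteq> dot_verts n" "a \<inter> b = {}"
    "card a = k - j" "card b = j"
    by (auto simp: C_set_def)
  then have "p \<in> vp.span (mon ` {x \<in> faces n k. x \<subseteq> (a \<union> b) \<union> bar ` (a \<union> b)})"
    using bracket_eigenvector[of a b n] finite_subset[OF _ finite_dot_verts] assms by auto
  then show "p \<in> M_space n k"
    unfolding M_space_def by (rule subsetD[OF vp.span_mono, rotated]) auto
qed

lemma M_space_eq_span_C_set:
  assumes "(2::'f::field) \<noteq> 0"
  shows "M_space n k = vp.span (\<Union>j\<in>{0..k}. C_set n k j :: 'f vpoly set)"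
proof
  have "mon x \<in> vp.span (\<Union>j\<in>{0..k}. C_set n k j :: 'f vpoly set)" if "x \<in> faces n k" for x
    using that mult_mon_mem_span_brackets[OF finite_face[OF that] assms, of "{}" n "{}" k]
    by (simp add: faces_iff bracket_def)
  then show "M_space n k \<subseteq> vp.span (\<Union>j\<in>{0..k}. C_set n k j :: 'f vpoly set)"
    unfolding M_space_def by (intro vp.span_minimal vp.subspace_span) auto
  show "vp.span (\<Union>j\<in>{0..k}. C_set n k j :: 'f vpoly set) \<subseteq> M_space n k"
    using C_set_subset_M_space unfolding M_space_def
    by (intro vp.span_minimal vp.subspace_span) fastforce
qed

section \<open>Independence and distinctness of the brackets by counting\<close>

lemma card_disjoint_pairs_le_card_faces:
  "card (\<Union>j\<in>{0..k}. disjoint_pairs n k j) \<le> card (faces n k)"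
proof (rule card_inj_on_le)
  \<comment> \<open>This picks one monomial of the expanded bracket: the unbarred vertex from each
    plus factor, the barred one from each minus factor. Its unbarred part recovers \<open>a\<close>,
    its barred part \<open>b\<close>.\<close>
  let ?f = "\<lambda>(a, b). a \<union> bar ` b"
  have inj_bar: "inj_on bar b" for b
    by (rule inj_onI) simp
  have "a = (a \<union> bar ` b) \<inter> dot_verts n \<and> b = bar ` ((a \<union> bar ` b) - dot_verts n)"
    if "a \<subseteq> dot_verts n" "b \<subseteq> dot_verts n" for a b
  proof -
    have "bar ` b \<inter> dot_verts n = {}"
      using that bar_mem_dot_verts by auto
    then have "(a \<union> bar ` b) - dot_verts n = bar ` b"
      using that by auto
    then show ?thesis
      using that \<open>bar ` b \<inter> dot_verts n = {}\<close> by (auto simp: image_image)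
  qed
  then show "inj_on ?f (\<Union>j\<in>{0..k}. disjoint_pairs n k j)"
    by (intro inj_onI) (clarsimp simp: disjoint_pairs_def, metis)
  show "?f ` (\<Union>j\<in>{0..k}. disjoint_pairs n k j) \<subseteq> faces n k"
  proof clarsimp
    fix a b j
    assume "j \<le> k" "(a, b) \<in> disjoint_pairs n k j"
    then have ab: "a \<subseteq> dot_verts n" "b \<subseteq> dot_verts n" "a \<inter> b = {}" "card a + card b = k"
      by (auto simp: disjoint_pairs_def)
    have "finite a" "finite b"
      using ab finite_subset[OF _ finite_dot_verts] by blast+
    moreover have "a \<inter> bar ` b = {}"
      using ab bar_mem_dot_verts by blast
    ultimately have "card (a \<union> bar ` b) = k"
      using ab by (simp add: card_Un_disjoint card_image inj_bar)
    moreover have "\<forall>v\<in>a \<union> bar ` b. bar v \<notin> a \<union> bar ` b"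
      using ab(1-3) by (auto simp: subset_iff) (metis bar_mem_dot_verts)+
    moreover have "a \<union> bar ` b \<subseteq> verts n"
      using ab dot_verts_subset_verts[of n] by auto
    ultimately show "a \<union> bar ` b \<in> faces n k"
      by (simp add: faces_iff)
  qed
qed (rule finite_faces)

text \<open>A closed chain of inequalities: \<open>card ?C \<le> card ?P \<le> card (faces n k) =
  vp.dim ?C \<le> card ?C\<close>. Equality throughout makes the spanning set \<open>?C\<close> a
  basis and the map from pairs to brackets injective.\<close>

lemma brackets_independent_inj:
  assumes "(2::'f::field) \<noteq> 0"
  shows "vp.independent (\<Union>j\<in>{0..k}. C_set n k j :: 'f vpoly set)"
    and "inj_on (\<lambda>(a, b). bracket a b :: 'f vpoly) (\<Union>j\<in>{0..k}. disjoint_pairs n k j)"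
proof -
  let ?P = "\<Union>j\<in>{0..k}. disjoint_pairs n k j"
  let ?C = "\<Union>j\<in>{0..k}. C_set n k j :: 'f vpoly set"
  have finP: "finite ?P"
    by (simp add: finite_disjoint_pairs)
  have C: "?C = (\<lambda>(a, b). bracket a b) ` ?P"
    by (auto simp: C_set_eq)
  then have finC: "finite ?C"
    using finP by simp
  \<comment> \<open>Dimension depends only on the span, and brackets and faces have the same span
    when \<open>2\<close> is invertible.\<close>
  have "vp.dim ?C = vp.dim (mon ` faces n k :: 'f vpoly set)"
    using M_space_eq_span_C_set[OF assms, of n k] unfolding M_space_def
    by (metis vp.dim_span)
  also have "\<dots> = card (faces n k)"
    by (simp add: vp.dim_eq_card_independent independent_faces card_image inj_on_mon)
  finally have dim: "vp.dim ?C = card (faces n k)" .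
  have le: "card ?C \<le> card ?P"
    unfolding C using finP by (rule card_image_le)
  have P_le: "card ?P \<le> vp.dim ?C"
    unfolding dim by (rule card_disjoint_pairs_le_card_faces)
  show "vp.independent ?C"
    using finC le P_le by (intro vp.independent_if_card_le_dim) auto
  have "vp.dim ?C \<le> card ?C"
    using finC by (rule vp.dim_le_card[OF vp.span_superset])
  then show "inj_on (\<lambda>(a, b). bracket a b :: 'f vpoly) ?P"
    using finP le P_le C by (intro eq_card_imp_inj_on) auto
qed

section \<open>Direct decomposition, dimensions and eigenvalues\<close>

theorem theorem2p3:
  fixes n k :: nat
  assumes "CHAR('f::field) \<noteq> 2"
    and "k \<le> n"
  shows "is_direct_sum (M_space n k :: 'f vpoly set) {0..k} (E_space n k)
    \<and> (\<forall>j\<le>k. vp.dim (E_space n k j :: 'f vpoly set) = (n choose k) * (k choose j)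
         \<and> vp.independent (C_set n k j :: 'f vpoly set)
         \<and> vp.span (C_set n k j :: 'f vpoly set) = E_space n k j)
    \<and> (\<forall>j\<le>k. sigma n k ` (E_space n k j :: 'f vpoly set) \<subseteq> E_space n k j
         \<and> (\<forall>v \<in> (E_space n k j :: 'f vpoly set).
              sigma n k v = scale (of_int (int k - 2 * int j)) v))"
proof -
  \<comment> \<open>Otherwise the characteristic divides the prime \<open>2\<close> and is not
    \<open>1\<close>, so it is \<open>2\<close>. Characteristic \<open>0\<close> is covered, as
    \<open>0\<close> does not divide \<open>2\<close>.\<close>
  have two: "(2::'f) \<noteq> 0"
  proof
    assume "(2::'f) = 0"
    then have "CHAR('f) dvd 2"
      by (metis of_nat_eq_0_iff_char_dvd of_nat_numeral)
    then show False
      using assms(1) two_is_prime_nat CHAR_not_1[where 'a = 'f] by (auto simp: prime_nat_iff)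
  qed
  note ind = brackets_independent_inj(1)[OF two, of n k]
  note inj = brackets_independent_inj(2)[OF two, of n k]
  have fin: "finite (C_set n k j :: 'f vpoly set)" for j
    by (simp add: C_set_eq finite_disjoint_pairs)
  have disj: "disjoint_family_on (C_set n k :: nat \<Rightarrow> 'f vpoly set) {0..k}"
    unfolding disjoint_family_on_def
  proof (intro ballI impI)
    fix i j
    assume ij: "i \<in> {0..k}" "j \<in> {0..k}" "i \<noteq> j"
    \<comment> \<open>Pairs for different indices differ in \<open>card b\<close>. Injectivity on
      the union over all indices, not just for each one, carries this over to the brackets.\<close>
    have "disjoint_pairs n k i \<inter> disjoint_pairs n k j = {}"
      using ij by (auto simp: disjoint_pairs_def)
    then show "C_set n k i \<inter> C_set n k j = ({} :: 'f vpoly set)"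
      unfolding C_set_eq using ij by (subst inj_on_image_Int[OF inj, symmetric]) auto
  qed
  have "is_direct_sum (M_space n k :: 'f vpoly set) {0..k} (E_space n k)"
    unfolding is_direct_sum_def
  proof (intro conjI ballI)
    show "vp.subspace (M_space n k :: 'f vpoly set)"
      by (simp add: M_space_def)
    show "vp.subspace (E_space n k j :: 'f vpoly set)" for j
      by (simp add: E_space_def)
    show "(E_space n k j :: 'f vpoly set) \<subseteq> M_space n k" if "j \<in> {0..k}" for j
      unfolding E_space_def M_space_eq_span_C_set[OF two] using that by (intro vp.span_mono) auto
    show "\<exists>!u. u \<in> Pi\<^sub>E {0..k} (E_space n k) \<and> w = (\<Sum>i\<in>{0..k}. u i)"
      if "w \<in> M_space n k" for w :: "'f vpoly"
      unfolding E_space_def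
      using vp.span_disjoint_family_ex1[OF _ fin ind disj] that
      unfolding M_space_eq_span_C_set[OF two] by simp
  qed
  moreover have "vp.dim (E_space n k j :: 'f vpoly set) = (n choose k) * (k choose j)
      \<and> vp.independent (C_set n k j :: 'f vpoly set)
      \<and> vp.span (C_set n k j :: 'f vpoly set) = E_space n k j" if j: "j \<le> k" for j
  proof -
    have i: "vp.independent (C_set n k j :: 'f vpoly set)"
      using ind by (rule vp.independent_mono) (use j in auto)
    have "inj_on (\<lambda>(a, b). bracket a b :: 'f vpoly) (disjoint_pairs n k j)"
      using inj by (rule inj_on_subset) (use j in auto)
    then have "card (C_set n k j :: 'f vpoly set) = (n choose k) * (k choose j)"
      by (simp add: C_set_eq card_image card_disjoint_pairs j assms(2))
    then show ?thesis
      using i by (simp add: E_space_def vp.dim_eq_card_independent)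
  qed
  moreover have eig: "sigma n k v = scale (of_int (int k - 2 * int j)) v"
    if j: "j \<le> k" and v: "v \<in> E_space n k j" for j and v :: "'f vpoly"
  proof -
    interpret s: Vector_Spaces.linear scale scale "sigma n k :: 'f vpoly \<Rightarrow> _"
      by (rule linear_sigma)
    show ?thesis
      using v unfolding E_space_def
    proof (induction rule: vp.span_induct_alt)
      case base
      then show ?case by (simp add: s.zero)
    next
      case (step c p q)
      then obtain a b where ab: "p = bracket a b" "a \<subseteq> dot_verts n" "b \<subseteq> dot_verts n"
        "a \<inter> b = {}" "card a = k - j" "card b = j"
        by (auto simp: C_set_def)
      \<comment> \<open>Since \<open>j \<le> k\<close>, the truncated \<open>k - j\<close> is the
        true difference, and \<open>(k - j) - j\<close> is taken in the integers, where it may be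
        negative.\<close>
      have "int (card a) - int (card b) = int k - 2 * int j" "card a + card b = k"
        using ab j by auto
      then have "sigma n k p = scale (of_int (int k - 2 * int j)) p"
        using bracket_eigenvector[of a b n] ab finite_subset[OF _ finite_dot_verts] by metis
      then show ?case
        using step by (simp add: s.add s.scale vp.scale_right_distrib mult.commute)
    qed
  qed
  moreover have "sigma n k v \<in> E_space n k j"
    if "j \<le> k" "v \<in> E_space n k j" for j and v :: "'f vpoly"
    using that by (simp add: eig) (simp add: E_space_def vp.span_scale)
  ultimately show ?thesis by auto
qed

end
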